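(* Let $n,m\ge 1$, let $U_1,U_2,\dots,U_{n+m}$ be uniform $[0,1]$ random variables on a common probability space, and let $C$ be their $(n+m)$-copula. Let $\mathbf{U}=(U_1,\dots,U_n)$ and let $C_{\mathbf{U}}$ be its copula. If $n\ge 2$, suppose that $\lambda_n \ll V_{C_{\mathbf{U}}}\ll\lambda_n$ (where $\lambda_n$ is Lebesgue measure on $[0,1]^n$). Suppose that for each $i\in\{1,\dots,m\}$ there exists a Borel function $f_i\colon[0,1]^n\to[0,1]$ such that $U_{n+i}=f_i(\mathbf{U})$ almost surely. Then $\operatorname{supp} C$ is an $n$-essentially closed set. In particular, $\operatorname{supp} C$ has local Hausdorff dimension at least $n$, i.e. for every open set $G\subseteq\mathbb{R}^{n+m}$ with $G\cap\operatorname{supp}C\ne\emptyset$, the Hausdorff dimension of $G\cap\operatorname{supp} C$ is at least $n$.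
   Context: A $k$-copula is a function $C\colon [0,1]^k \to [0,1]$ such that (i) $C(u_1,\dots,u_{i-1},0,u_{i+1},\dots,u_k)=0$; (ii) $C(1,\dots,1,u_i,1,\dots,1)=u_i$; (iii) $C$ is $k$-increasing: for each hyperrectangle $B=\prod_{i=1}^k [x_i,y_i]\subseteq[0,1]^k$, $V_C(B)=\sum_{z\in\prod_{i=1}^k\{x_i,y_i\}}(-1)^{N(z)}C(z)\ge 0$, where $N(z)$ is the size of $\{i\colon z_i=x_i\}$. The set function $V_C$ extends uniquely to a Borel probability measure on $[0,1]^k$, also denoted $V_C$. The support $\operatorname{supp} C$ is the topological support of the measure $V_C$. The copula of uniform $[0,1]$ random variables is their joint distribution function on $[0,1]^k$, so $V_C$ is their joint law. A standard subspace of $\mathbb{R}^k$ is a subspace spanned by standard basis vectors. $\lambda_d$ and $\lambda_d^*$ denote $d$-dimensional Lebesgue measure and outer measure (a $d$-dimensional standard subspace being identified with $\mathbb{R}^d$), with $\lambda_0=\lambda_0^*$ the counting measure. $\pi_W$ is the orthogonal projection onto $W$. For $A\subseteq\mathbb{R}^k$ and an integer $0\le d\le k$, the $d$-essential closure $\widehat{A}^{d}$ of $A$ is the set of all $x\in\mathbb{R}^k$ such that for every open neighborhood $G$ of $x$ there exists a $d$-dimensional standard subspace $W$ with $\lambda_d^*(\pi_W(G\cap A))>0$. The set $A$ is $d$-essentially closed if $A=\widehat{A}^{d}$. *)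

theory Defs
  imports "HOL-Probability.Probability"
begin

section \<open>Copulas\<close>

abbreviation unit_cube :: "(real ^ 'k) set" where
  "unit_cube \<equiv> cbox 0 1"

text \<open>
  The alternating sum over the vertices of \<open>cbox x y\<close>. A vertex is given by the set \<open>S\<close> of the
  coordinates in which it agrees with \<open>x\<close>, so that a degenerate box (\<open>x $ i = y $ i\<close> for
  some \<open>i\<close>) has all its vertices counted with multiplicity and gets volume 0.
\<close>
definition copula_volume :: "(real ^ 'k \<Rightarrow> real) \<Rightarrow> real ^ 'k \<Rightarrow> real ^ 'k \<Rightarrow> real" where
  "copula_volume C x y =
     (\<Sum>S\<in>(UNIV :: 'k::finite set set). (-1) ^ card S * C (\<chi> i. if i \<in> S then x $ i else y $ i))"

text \<open>Only the values of \<open>C\<close> on \<open>unit_cube\<close> matter, here and below.\<close>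
definition copula :: "(real ^ 'k \<Rightarrow> real) \<Rightarrow> bool" where
  "copula C \<longleftrightarrow>
     (\<forall>u\<in>unit_cube. C u \<in> {0..1}) \<and>
     (\<forall>u\<in>unit_cube. (\<exists>i. u $ i = 0) \<longrightarrow> C u = 0) \<and>
     (\<forall>i::'k::finite. \<forall>t\<in>{0..1}. C (\<chi> j. if j = i then t else 1) = t) \<and>
     (\<forall>x\<in>unit_cube. \<forall>y\<in>unit_cube. (\<forall>i. x $ i \<le> y $ i) \<longrightarrow> copula_volume C x y \<ge> 0)"

definition extends_copula_volume :: "(real ^ 'k::finite) measure \<Rightarrow> (real ^ 'k \<Rightarrow> real) \<Rightarrow> bool" where
  "extends_copula_volume \<mu> C \<longleftrightarrow>
     prob_space \<mu> \<and> sets \<mu> = sets (restrict_space borel unit_cube) \<and>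
     (\<forall>x\<in>unit_cube. \<forall>y\<in>unit_cube. (\<forall>i. x $ i \<le> y $ i) \<longrightarrow>
        measure \<mu> (cbox x y) = copula_volume C x y)"

definition copula_measure :: "(real ^ 'k::finite \<Rightarrow> real) \<Rightarrow> (real ^ 'k) measure" where
  "copula_measure C = (THE \<mu>. extends_copula_volume \<mu> C)"

definition measure_support :: "'a::topological_space measure \<Rightarrow> 'a set" where
  "measure_support \<mu> = {x\<in>space \<mu>. \<forall>G. open G \<longrightarrow> x \<in> G \<longrightarrow> emeasure \<mu> (G \<inter> space \<mu>) > 0}"

definition copula_support :: "(real ^ 'k::finite \<Rightarrow> real) \<Rightarrow> (real ^ 'k) set" where
  "copula_support C = measure_support (copula_measure C)"

definition uniform01 :: "'w measure \<Rightarrow> ('w \<Rightarrow> real) \<Rightarrow> bool" where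
  "uniform01 M X \<longleftrightarrow> X \<in> borel_measurable M \<and> distr M borel X = uniform_measure lborel {0..1}"

definition copula_of :: "'w measure \<Rightarrow> ('k::finite \<Rightarrow> 'w \<Rightarrow> real) \<Rightarrow> real ^ 'k \<Rightarrow> real" where
  "copula_of M X u = measure M {\<omega>\<in>space M. \<forall>i. X i \<omega> \<le> u $ i}"


subsection \<open>The copula of uniform random variables is a copula, and its measure is their law\<close>

lemma uniform01_point_null:
  assumes "prob_space M" "uniform01 M X"
  shows "AE \<omega> in M. X \<omega> \<noteq> a"
proof -
  have m[measurable]: "X \<in> borel_measurable M" using assms by (simp add: uniform01_def)
  have "AE x in uniform_measure lborel {0..1::real}. x \<noteq> a"
    by (rule AE_uniform_measureI) (use AE_lborel_singleton[of a] in auto)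
  then have "AE x in distr M borel X. x \<noteq> a"
    by (subst conjunct2[OF assms(2)[unfolded uniform01_def]])
  then show ?thesis by (subst (asm) AE_distr_iff) auto
qed

lemma uniform01_range:
  assumes "prob_space M" "uniform01 M X"
  shows "AE \<omega> in M. X \<omega> \<in> {0..1}"
proof -
  have m[measurable]: "X \<in> borel_measurable M" using assms by (simp add: uniform01_def)
  have "AE x in uniform_measure lborel {0..1::real}. x \<in> {0..1}"
    by (rule AE_uniform_measureI) auto
  then have "AE x in distr M borel X. x \<in> {0..1}"
    by (subst conjunct2[OF assms(2)[unfolded uniform01_def]])
  then show ?thesis by (subst (asm) AE_distr_iff) auto
qed

lemma uniform01_cdf:
  assumes "prob_space M" "uniform01 M X" "t \<in> {0..1}"
  shows "measure M {\<omega>\<in>space M. X \<omega> \<le> t} = t"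
proof -
  have m[measurable]: "X \<in> borel_measurable M" using assms by (simp add: uniform01_def)
  have "measure M {\<omega>\<in>space M. X \<omega> \<le> t} = measure (distr M borel X) {..t}"
    by (subst measure_distr) (auto intro!: arg_cong[where f="measure M"])
  also have "\<dots> = measure lborel ({0..1} \<inter> {..t}) / measure lborel {0..1::real}"
    using assms by (simp add: uniform01_def measure_uniform_measure)
  also have "{0..1} \<inter> {..t} = {0..t}" using assms by auto
  finally show ?thesis using assms by simp
qed

lemma copula_volume_copula_of:
  fixes X :: "'k::finite \<Rightarrow> 'w \<Rightarrow> real"
  assumes "prob_space M" and u: "\<And>i. uniform01 M (X i)" and le: "\<forall>i. x $ i \<le> y $ i"
  shows "copula_volume (copula_of M X) x y = measure M {\<omega>\<in>space M. (\<chi> i. X i \<omega>) \<in> cbox x y}"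
proof -
  interpret prob_space M by fact
  have m[measurable]: "X i \<in> borel_measurable M" for i using u by (simp add: uniform01_def)
  let ?A = "\<lambda>S. {\<omega>\<in>space M. \<forall>i. X i \<omega> \<le> (if i \<in> S then x $ i else y $ i)}"
  have A[measurable]: "?A S \<in> sets M" for S by measurable
  have *: "(\<Sum>S\<in>UNIV. (-1) ^ card S * indicator (?A S) \<omega>) =
      (indicator {\<omega>\<in>space M. \<forall>i. x $ i < X i \<omega> \<and> X i \<omega> \<le> y $ i} \<omega> :: real)" if "\<omega> \<in> space M" for \<omega>
  proof -
    let ?a = "\<lambda>i. of_bool (X i \<omega> \<le> x $ i) :: real" and ?b = "\<lambda>i. of_bool (X i \<omega> \<le> y $ i) :: real"
    have "(\<Prod>i\<in>UNIV. - ?a i + ?b i) = (\<Sum>S\<in>Pow UNIV. (\<Prod>i\<in>S. - ?a i) * (\<Prod>i\<in>UNIV-S. ?b i))"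
      by (rule prod_add) auto
    also have "\<dots> = (\<Sum>S\<in>UNIV. (-1) ^ card S * indicator (?A S) \<omega>)"
    proof (rule sum.cong)
      fix S :: "'k set"
      have "(\<Prod>i\<in>S. ?a i) * (\<Prod>i\<in>UNIV-S. ?b i) = (indicator (?A S) \<omega> :: real)"
        using that by (auto simp: indicator_def)
      then show "(\<Prod>i\<in>S. - ?a i) * (\<Prod>i\<in>UNIV-S. ?b i) = (-1) ^ card S * indicator (?A S) \<omega>"
        by (simp add: prod_uminus mult.assoc)
    qed simp
    finally have "(\<Sum>S\<in>UNIV. (-1) ^ card S * indicator (?A S) \<omega>) = (\<Prod>i\<in>UNIV. - ?a i + ?b i)" ..
    also have "\<dots> = (\<Prod>i\<in>UNIV. of_bool (x $ i < X i \<omega> \<and> X i \<omega> \<le> y $ i))"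
      by (rule prod.cong) (use le in \<open>auto simp: not_le intro: order_trans\<close>)
    also have "\<dots> = indicator {\<omega>\<in>space M. \<forall>i. x $ i < X i \<omega> \<and> X i \<omega> \<le> y $ i} \<omega>"
      using that by (auto simp: indicator_def)
    finally show ?thesis .
  qed
  have "copula_volume (copula_of M X) x y = (\<Sum>S\<in>UNIV. (-1) ^ card S * measure M (?A S))"
    by (simp add: copula_volume_def copula_of_def)
  also have "\<dots> = (\<Sum>S\<in>UNIV. \<integral>\<omega>. (-1) ^ card S * indicator (?A S) \<omega> \<partial>M)"
    by (intro sum.cong) (auto simp: Int_absorb2)
  also have "\<dots> = (\<integral>\<omega>. (\<Sum>S\<in>UNIV. (-1) ^ card S * indicator (?A S) \<omega>) \<partial>M)"
    by (rule Bochner_Integration.integral_sum[symmetric])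
      (intro integrable_mult_right integrable_real_indicator A, simp add: less_top[symmetric])
  also have "\<dots> = (\<integral>\<omega>. indicator {\<omega>\<in>space M. \<forall>i. x $ i < X i \<omega> \<and> X i \<omega> \<le> y $ i} \<omega> \<partial>M)"
    by (rule Bochner_Integration.integral_cong) (use * in auto)
  also have "\<dots> = measure M {\<omega>\<in>space M. \<forall>i. x $ i < X i \<omega> \<and> X i \<omega> \<le> y $ i}"
    by (simp add: Int_def conj_commute)
  also have "\<dots> = measure M {\<omega>\<in>space M. (\<chi> i. X i \<omega>) \<in> cbox x y}"
  proof (rule finite_measure_eq_AE)
    have "AE \<omega> in M. \<forall>i. X i \<omega> \<noteq> x $ i"
      using uniform01_point_null[OF assms(1) u] by (subst AE_all_countable) auto
    then show "AE \<omega> in M. (\<omega> \<in> {\<omega>\<in>space M. \<forall>i. x $ i < X i \<omega> \<and> X i \<omega> \<le> y $ i}) =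
        (\<omega> \<in> {\<omega>\<in>space M. (\<chi> i. X i \<omega>) \<in> cbox x y})"
      by eventually_elim (simp add: mem_box_cart less_le, metis)
  qed (simp_all add: mem_box_cart)
  finally show ?thesis .
qed

lemma copula_copula_of:
  fixes X :: "'k::finite \<Rightarrow> 'w \<Rightarrow> real"
  assumes "prob_space M" and u: "\<And>i. uniform01 M (X i)"
  shows "copula (copula_of M X)"
proof -
  interpret prob_space M by fact
  have m[measurable]: "X i \<in> borel_measurable M" for i using u by (simp add: uniform01_def)
  have "copula_of M X v = 0" if "v $ i = 0" for v i
  proof -
    have "copula_of M X v \<le> measure M {\<omega>\<in>space M. X i \<omega> \<le> 0}"
      unfolding copula_of_def by (rule finite_measure_mono) (use that in \<open>auto, metis\<close>)
    then show ?thesis using uniform01_cdf[OF assms(1) u, of 0 i] by (auto simp: copula_of_def measure_le_0_iff)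
  qed
  moreover have "copula_of M X (\<chi> j. if j = i then t else 1) = t" if "t \<in> {0..1}" for i t
  proof -
    have "AE \<omega> in M. \<forall>j. X j \<omega> \<in> {0..1}"
      using uniform01_range[OF assms(1) u] by (subst AE_all_countable) auto
    then have "AE \<omega> in M. (\<omega> \<in> {\<omega>\<in>space M. \<forall>j. X j \<omega> \<le> (\<chi> j. if j = i then t else 1) $ j}) =
       (\<omega> \<in> {\<omega>\<in>space M. X i \<omega> \<le> t})"
      by eventually_elim (auto split: if_splits)
    then have "copula_of M X (\<chi> j. if j = i then t else 1) = measure M {\<omega>\<in>space M. X i \<omega> \<le> t}"
      unfolding copula_of_def by (rule finite_measure_eq_AE) auto
    then show ?thesis using uniform01_cdf[OF assms(1) u that] by simp
  qed
  ultimately show ?thesis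
    by (auto simp: copula_def copula_volume_copula_of[OF assms] copula_of_def)
qed

lemma extends_copula_volume_unique:
  fixes C :: "real ^ 'k::finite \<Rightarrow> real"
  assumes \<mu>: "extends_copula_volume \<mu> C" and \<nu>: "extends_copula_volume \<nu> C"
  shows "\<mu> = \<nu>"
proof -
  have sets: "sets \<mu> = sets (restrict_space borel unit_cube)" "sets \<nu> = sets (restrict_space borel unit_cube)"
    using \<mu> \<nu> by (auto simp: extends_copula_volume_def)
  have space: "space \<mu> = unit_cube" "space \<nu> = unit_cube"
    using sets[THEN sets_eq_imp_space_eq] by (auto simp: space_restrict_space)
  have id: "(\<lambda>x. x) \<in> \<mu> \<rightarrow>\<^sub>M borel" "(\<lambda>x. x) \<in> \<nu> \<rightarrow>\<^sub>M borel"
    unfolding measurable_cong_sets[OF sets(1) refl] measurable_cong_sets[OF sets(2) refl]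
    by (simp_all add: measurable_restrict_space1)
  interpret \<mu>: prob_space \<mu> using \<mu> by (simp add: extends_copula_volume_def)
  interpret \<nu>: prob_space \<nu> using \<nu> by (simp add: extends_copula_volume_def)
  have lower: "emeasure \<mu> ({..a} \<inter> unit_cube) = emeasure \<nu> ({..a} \<inter> unit_cube)" for a :: "real ^ 'k"
  proof (cases "\<forall>i. 0 \<le> a $ i")
    case True
    let ?b = "(\<chi> i. min (a $ i) 1) :: real ^ 'k"
    have b: "{..a} \<inter> unit_cube = cbox 0 ?b"
      by (auto simp: mem_box_cart less_eq_vec_def)
    have "measure \<mu> (cbox 0 ?b) = measure \<nu> (cbox 0 ?b)"
      using \<mu> \<nu> True by (simp add: extends_copula_volume_def mem_box_cart)
    then show ?thesis by (simp add: b \<mu>.emeasure_eq_measure \<nu>.emeasure_eq_measure)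
  next
    case False
    then have "{..a} \<inter> unit_cube = {}"
      by (auto simp: mem_box_cart less_eq_vec_def) (meson order_trans)
    then show ?thesis by (metis emeasure_empty)
  qed
  have "distr \<mu> borel (\<lambda>x. x) = distr \<nu> borel (\<lambda>x. x)"
  proof (rule measure_eqI_generator_eq)
    let ?E = "range (\<lambda>a. {..a :: real ^ 'k})"
    have "{..a} \<inter> {..b} = {..(\<chi> i. min (a $ i) (b $ i))}" for a b :: "real ^ 'k"
      by (auto simp: less_eq_vec_def)
    then show "Int_stable ?E" by (auto simp: Int_stable_def)
    show "sets (distr \<mu> borel (\<lambda>x. x)) = sigma_sets UNIV ?E" "sets (distr \<nu> borel (\<lambda>x. x)) = sigma_sets UNIV ?E"
      by (simp_all add: borel_eq_atMost)
    show "range (\<lambda>n::nat. {..real n *\<^sub>R (1::real^'k)}) \<subseteq> ?E" by auto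
    show "(\<Union>n::nat. {..real n *\<^sub>R (1::real^'k)}) = UNIV"
    proof safe
      fix x :: "real ^ 'k"
      obtain n where "norm x \<le> real n" using real_arch_simple by blast
      then have "x \<le> real n *\<^sub>R 1"
        by (auto simp: less_eq_vec_def intro: order_trans[OF abs_ge_self] order_trans[OF component_le_norm_cart])
      then show "x \<in> (\<Union>n::nat. {..real n *\<^sub>R (1::real^'k)})" by auto
    qed auto
    show "emeasure (distr \<mu> borel (\<lambda>x. x)) {..real n *\<^sub>R 1} \<noteq> \<infinity>" for n
      using id by (subst emeasure_distr) auto
    show "emeasure (distr \<mu> borel (\<lambda>x. x)) A = emeasure (distr \<nu> borel (\<lambda>x. x)) A" if "A \<in> ?E" for A
      using that id lower by (auto simp: emeasure_distr space)
  qed auto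
  then have *: "emeasure \<mu> (A \<inter> unit_cube) = emeasure \<nu> (A \<inter> unit_cube)" if "A \<in> sets borel" for A
    using that emeasure_distr[OF id(1) that] emeasure_distr[OF id(2) that] by (simp add: space)
  show ?thesis
  proof (rule measure_eqI)
    fix A assume "A \<in> sets \<mu>"
    then obtain B where "B \<in> sets borel" "A = unit_cube \<inter> B" by (auto simp: sets sets_restrict_space)
    then show "emeasure \<mu> A = emeasure \<nu> A" using * by (simp add: Int_commute)
  qed (simp add: sets)
qed

lemma copula_measure_copula_of:
  fixes X :: "'k::finite \<Rightarrow> 'w \<Rightarrow> real"
  assumes "prob_space M" and u: "\<And>i. uniform01 M (X i)"
  shows "extends_copula_volume (copula_measure (copula_of M X)) (copula_of M X)"
    and "copula_measure (copula_of M X) = restrict_space (distr M borel (\<lambda>\<omega>. \<chi> i. X i \<omega>)) unit_cube"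
proof -
  interpret prob_space M by fact
  have m[measurable]: "X i \<in> borel_measurable M" for i using u by (simp add: uniform01_def)
  have Y[measurable]: "(\<lambda>\<omega>. \<chi> i. X i \<omega>) \<in> borel_measurable M"
    by (subst borel_measurable_euclidean_space) (auto simp: Basis_vec_def inner_axis)
  let ?D = "distr M borel (\<lambda>\<omega>. \<chi> i. X i \<omega>)"
  have "AE \<omega> in M. \<forall>j. X j \<omega> \<in> {0..1}"
    using uniform01_range[OF assms(1) u] by (subst AE_all_countable) auto
  then have "AE x in ?D. x \<in> unit_cube"
    by (subst AE_distr_iff) (auto simp: mem_box_cart)
  then have "emeasure ?D unit_cube = 1"
    using prob_space.emeasure_eq_1_AE[OF prob_space_distr[OF Y]] by simp
  then have "prob_space (restrict_space ?D unit_cube)"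
    by (intro prob_spaceI) (simp add: emeasure_restrict_space space_restrict_space)
  moreover have "measure (restrict_space ?D unit_cube) (cbox x y) = copula_volume (copula_of M X) x y"
    if "x \<in> unit_cube" "y \<in> unit_cube" "\<forall>i. x $ i \<le> y $ i" for x y
  proof -
    have sub: "cbox x y \<subseteq> unit_cube"
      using that by (intro subsetI) (unfold mem_box_cart, meson order_trans)
    then have "measure (restrict_space ?D unit_cube) (cbox x y) = measure ?D (cbox x y)"
      by (intro measure_restrict_space) auto
    also have "\<dots> = measure M {\<omega>\<in>space M. (\<chi> i. X i \<omega>) \<in> cbox x y}"
      by (subst measure_distr) (auto intro!: arg_cong[where f="measure M"])
    finally show ?thesis using copula_volume_copula_of[OF assms that(3)] by simp
  qed
  ultimately have *: "extends_copula_volume (restrict_space ?D unit_cube) (copula_of M X)"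
    by (auto simp: extends_copula_volume_def sets_restrict_space)
  show eq: "copula_measure (copula_of M X) = restrict_space ?D unit_cube"
    unfolding copula_measure_def using * extends_copula_volume_unique by blast
  show "extends_copula_volume (copula_measure (copula_of M X)) (copula_of M X)"
    using * eq by simp
qed


section \<open>Essential closures\<close>

definition std_subspace :: "'a::euclidean_space set \<Rightarrow> bool" where
  "std_subspace W \<longleftrightarrow> (\<exists>B\<subseteq>Basis. W = span B)"

definition orth_proj :: "'a::euclidean_space set \<Rightarrow> 'a \<Rightarrow> 'a" where
  "orth_proj W x = (THE y. y \<in> W \<and> (\<forall>w\<in>W. orthogonal (x - y) w))"

text \<open>
  A standard subspace \<open>W\<close> is identified with the functions on \<open>Basis \<inter> W\<close> by taking coordinates.
  For \<open>W = {0}\<close> the product measure is the counting measure on a single point.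
\<close>
definition lebesgue_outer_on :: "'a::euclidean_space set \<Rightarrow> 'a set \<Rightarrow> ennreal" where
  "lebesgue_outer_on W S =
     outer_measure_of (\<Pi>\<^sub>M b\<in>Basis \<inter> W. lborel) ((\<lambda>x. \<lambda>b\<in>Basis \<inter> W. x \<bullet> b) ` S)"

definition ess_closure :: "nat \<Rightarrow> 'a::euclidean_space set \<Rightarrow> 'a set" where
  "ess_closure d A =
     {x. \<forall>G. open G \<longrightarrow> x \<in> G \<longrightarrow>
        (\<exists>W. std_subspace W \<and> dim W = d \<and> lebesgue_outer_on W (orth_proj W ` (G \<inter> A)) > 0)}"

definition ess_closed :: "nat \<Rightarrow> 'a::euclidean_space set \<Rightarrow> bool" where
  "ess_closed d A \<longleftrightarrow> A = ess_closure d A"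


section \<open>Hausdorff dimension\<close>

text \<open>The convention is \<open>diameter {} ^ 0 = 0\<close>, but \<open>diameter E ^ 0 = 1\<close> for every nonempty \<open>E\<close>.\<close>
definition diam_powr :: "real \<Rightarrow> 'a::metric_space set \<Rightarrow> ennreal" where
  "diam_powr s E = (if E = {} then 0 else if s = 0 then 1 else ennreal (diameter E powr s))"

definition hausdorff_premeasure :: "real \<Rightarrow> real \<Rightarrow> 'a::metric_space set \<Rightarrow> ennreal" where
  "hausdorff_premeasure s \<delta> A =
     (INF E \<in> {E :: nat \<Rightarrow> 'a set. A \<subseteq> (\<Union>i. E i) \<and> (\<forall>i. bounded (E i) \<and> diameter (E i) \<le> \<delta>)}.
        \<Sum>i. diam_powr s (E i))"

definition hausdorff_measure :: "real \<Rightarrow> 'a::metric_space set \<Rightarrow> ennreal" where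
  "hausdorff_measure s A = (SUP \<delta>\<in>{0<..}. hausdorff_premeasure s \<delta> A)"

definition hausdorff_dim :: "'a::metric_space set \<Rightarrow> ennreal" where
  "hausdorff_dim A = (INF s\<in>{s. s \<ge> 0 \<and> hausdorff_measure s A = 0}. ennreal s)"

end

theory Submission
  imports Defs
begin

text \<open>
  The support \<open>S\<close> carries all the mass, so an open \<open>G\<close> meeting \<open>S\<close> satisfies
  \<open>P((U\<^sub>1, \<dots>, U\<^sub>n\<^sub>+\<^sub>m) \<in> G \<inter> S) > 0\<close>. If the projection of \<open>G \<inter> S\<close> to the first \<open>n\<close> coordinates were
  contained in a Lebesgue null set \<open>N\<close>, then \<open>P((U\<^sub>1, \<dots>, U\<^sub>n) \<in> N) = 0\<close> by absolute continuity (by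
  uniformity of \<open>U\<^sub>1\<close> if \<open>n = 1\<close>), a contradiction. Hence these projections have positive outer measure,
  so \<open>S\<close> is contained in its essential closure, which is contained in the closure of \<open>S\<close>. Since the
  projection is 1-Lipschitz, vanishing \<open>s\<close>-dimensional Hausdorff measure of \<open>G \<inter> S\<close> for some \<open>s < n\<close>
  would also make it null.
\<close>

section \<open>Coordinates and projections for standard subspaces\<close>

lemma Basis_Int_span:
  assumes "B \<subseteq> Basis"
  shows "Basis \<inter> span B = B"
  using assms by (auto simp: span_substd_basis[OF assms] inner_Basis span_base split: if_splits)

text \<open>The residual of a projection is orthogonal to every \<open>b \<in> B\<close>, so it has
  no \<open>b\<close>-coordinate. Eliminating \<open>THE\<close> takes existence and uniqueness of
  the orthogonal decomposition.\<close>

lemma orth_proj_span_inner: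
  assumes B: "B \<subseteq> Basis" and "b \<in> B"
  shows "orth_proj (span B) x \<bullet> b = x \<bullet> b"
proof -
  have "orth_proj (span B) x \<in> span B \<and> (\<forall>w\<in>span B. orthogonal (x - orth_proj (span B) x) w)"
    unfolding orth_proj_def
  proof (rule theI')
    obtain y z where yz: "y \<in> span B" "\<And>w. w \<in> span B \<Longrightarrow> orthogonal z w" "x = y + z"
      using orthogonal_subspace_decomp_exists[of B x] by metis
    show "\<exists>!y. y \<in> span B \<and> (\<forall>w\<in>span B. orthogonal (x - y) w)"
    proof (rule ex1I[of _ y])
      \<comment> \<open>Uniqueness: two candidates differ by a vector of the span that is orthogonal
        to itself.\<close>
      fix u assume u: "u \<in> span B \<and> (\<forall>w\<in>span B. orthogonal (x - u) w)"
      have "u - y \<in> span B" using u yz span_diff by blast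
      then have "(x - u) \<bullet> (u - y) = 0" "(x - y) \<bullet> (u - y) = 0"
        using u yz by (auto simp: orthogonal_def)
      then have "(u - y) \<bullet> (u - y) = 0" by (simp add: inner_diff_left)
      then show "u = y" by simp
    qed (use yz in auto)
  qed
  then show ?thesis
    using span_base[OF \<open>b \<in> B\<close>] by (auto simp: orthogonal_def inner_diff_left)
qed

section \<open>Topological support of a measure\<close>

lemma closed_measure_support:
  assumes "closed (space \<mu>)"
  shows "closed (measure_support \<mu>)"
proof -
  have "- measure_support \<mu> = - space \<mu> \<union> \<Union>{G. open G \<and> emeasure \<mu> (G \<inter> space \<mu>) = 0}"
    by (auto simp: measure_support_def zero_less_iff_neq_zero)
  then show ?thesis using assms by (auto simp: closed_def)
qed

text \<open>Inside the space, the complement of the support is the union of all open null sets. By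
  Lindelof, a countable subfamily has the same union, which is therefore null.\<close>

lemma AE_measure_support:
  fixes \<mu> :: "'a::second_countable_topology measure"
  assumes "\<And>G. open G \<Longrightarrow> G \<inter> space \<mu> \<in> sets \<mu>"
  shows "AE x in \<mu>. x \<in> measure_support \<mu>"
proof -
  let ?F = "{G. open G \<and> emeasure \<mu> (G \<inter> space \<mu>) = 0}"
  obtain F where F: "F \<subseteq> ?F" "countable F" "\<Union>F = \<Union>?F"
    using Lindelof[of ?F] by auto
  have "AE x in \<mu>. \<forall>G\<in>F. x \<notin> G \<inter> space \<mu>"
  proof (subst AE_ball_countable[OF F(2)], intro ballI AE_not_in null_setsI)
    fix G assume "G \<in> F"
    then show "emeasure \<mu> (G \<inter> space \<mu>) = 0" "G \<inter> space \<mu> \<in> sets \<mu>" using F(1) assms by auto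
  qed
  then show ?thesis
  proof (rule AE_mp, intro AE_I2 impI)
    fix x assume x: "x \<in> space \<mu>" "\<forall>G\<in>F. x \<notin> G \<inter> space \<mu>"
    then have "x \<notin> \<Union>?F" unfolding F(3)[symmetric] by auto
    then show "x \<in> measure_support \<mu>"
      using x by (auto simp: measure_support_def zero_less_iff_neq_zero)
  qed
qed

section \<open>Product measures and Lebesgue measure on \<open>real ^ 'n\<close>\<close>

lemma vec_lambda_measurable:
  fixes X :: "'n::finite \<Rightarrow> 'w \<Rightarrow> real"
  assumes [measurable]: "\<And>i. X i \<in> borel_measurable M"
  shows "(\<lambda>\<omega>. \<chi> i. X i \<omega>) \<in> borel_measurable M"
  by (subst borel_measurable_euclidean_space) (auto simp: Basis_vec_def inner_axis)

lemma prod_ennreal_vec_Basis: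
  fixes l u :: "real ^ 'n::finite"
  assumes "\<And>j. l $ j \<le> u $ j"
  shows "(\<Prod>j\<in>UNIV. ennreal (u $ j - l $ j)) = (\<Prod>b\<in>Basis. (u - l) \<bullet> b)"
proof -
  have "bij_betw (\<lambda>j. axis j (1::real)) (UNIV :: 'n set) Basis"
    by (auto simp: bij_betw_def inj_on_def axis_eq_axis Basis_vec_def)
  then have "(\<Prod>b\<in>Basis. (u - l) \<bullet> b) = (\<Prod>j\<in>UNIV. u $ j - l $ j)"
    by (subst prod.reindex_bij_betw[symmetric]) (auto simp: inner_axis)
  then show ?thesis using assms by (simp add: prod_ennreal)
qed

text \<open>Lebesgue measure is determined by open boxes, and a box pulls back to a product of
  intervals reindexed by \<open>inv h\<close>. This transfers null sets between the product in
  \<open>lebesgue_outer_on\<close> and \<open>real ^ 'n\<close>.\<close>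

lemma distr_PiM_lborel_vec:
  fixes h :: "'n::finite \<Rightarrow> 'i"
  assumes "inj h"
  shows "distr (\<Pi>\<^sub>M i\<in>range h. lborel) borel (\<lambda>f. \<chi> j. f (h j)) = (lborel :: (real ^ 'n) measure)"
proof (rule lborel_eqI[symmetric])
  let ?P = "\<Pi>\<^sub>M i\<in>range h. (lborel :: real measure)"
  interpret product_sigma_finite "\<lambda>_. lborel :: real measure" ..
  have m: "(\<lambda>f. \<chi> j. f (h j)) \<in> borel_measurable ?P"
    by (rule vec_lambda_measurable) measurable
  fix l u :: "real ^ 'n"
  assume "\<And>b. b \<in> Basis \<Longrightarrow> l \<bullet> b \<le> u \<bullet> b"
  from this[of "axis j 1" for j] have le: "l $ j \<le> u $ j" for j
    by (simp add: axis_in_Basis_iff inner_axis)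
  have "(\<lambda>f. \<chi> j. f (h j)) -` box l u \<inter> space ?P = (\<Pi>\<^sub>E i\<in>range h. {l $ inv h i <..< u $ inv h i})"
    using assms by (auto simp: space_PiM PiE_iff mem_box_cart)
  then have "emeasure (distr ?P borel (\<lambda>f. \<chi> j. f (h j))) (box l u) =
      (\<Prod>i\<in>range h. emeasure lborel {l $ inv h i <..< u $ inv h i})"
    using m by (simp add: emeasure_distr emeasure_PiM)
  also have "\<dots> = (\<Prod>j\<in>UNIV. ennreal (u $ j - l $ j))"
    using assms le by (subst prod.reindex) auto
  finally show "emeasure (distr ?P borel (\<lambda>f. \<chi> j. f (h j))) (box l u) = (\<Prod>b\<in>Basis. (u - l) \<bullet> b)"
    using prod_ennreal_vec_Basis[OF le] by simp
qed simp

text \<open>Contrapositive: a projection of outer measure zero has a measurable null cover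
  \<open>E\<close>, and transporting \<open>E\<close> to \<open>real ^ 'n\<close> gives a null set
  containing the coordinate image of \<open>A\<close>.\<close>

lemma lebesgue_outer_on_pos:
  fixes A :: "'a::euclidean_space set" and h :: "'n::finite \<Rightarrow> 'a"
  assumes h: "inj h" "range h \<subseteq> Basis"
    and A: "\<And>N. N \<in> null_sets lborel \<Longrightarrow> \<not> (\<lambda>x. (\<chi> j. x \<bullet> h j) :: real ^ 'n) ` A \<subseteq> N"
  shows "lebesgue_outer_on (span (range h)) (orth_proj (span (range h)) ` A) > 0"
proof (rule ccontr)
  let ?I = "range h" and ?P = "\<Pi>\<^sub>M i\<in>range h. (lborel :: real measure)"
  define c where "c x = (\<lambda>b\<in>?I. x \<bullet> b)" for x :: 'a
  \<comment> \<open>On the product space \<open>g\<close> inverts the coordinate map of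
    \<open>distr_PiM_lborel_vec\<close>, so the preimage of \<open>E\<close> under \<open>g\<close>
    is the copy of \<open>E\<close> in \<open>real ^ 'n\<close>.\<close>
  define g where "g = (\<lambda>x :: real ^ 'n. \<lambda>i\<in>?I. x $ inv h i)"
  have g: "g \<in> borel \<rightarrow>\<^sub>M ?P" unfolding g_def by measurable
  assume "\<not> ?thesis"
  then have "outer_measure_of ?P (c ` orth_proj (span ?I) ` A) = 0"
    by (simp add: lebesgue_outer_on_def Basis_Int_span[OF h(2)] c_def[abs_def])
  \<comment> \<open>The projection drops out because \<open>c\<close> reads only the coordinates in
    \<open>range h\<close>, which it preserves.\<close>
  moreover have "c ` orth_proj (span ?I) ` A = c ` A"
    by (force simp: c_def orth_proj_span_inner[OF h(2)] image_image cong: restrict_cong)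
  moreover have "c ` A \<subseteq> space ?P" by (auto simp: c_def space_PiM)
  ultimately obtain E where E: "E \<in> sets ?P" "c ` A \<subseteq> E" "emeasure ?P E = 0"
    using outer_measure_of_attain by metis
  have N: "g -` E \<in> sets borel" using measurable_sets[OF g E(1)] by simp
  have m: "(\<lambda>f. (\<chi> j. f (h j)) :: real ^ 'n) \<in> borel_measurable ?P"
    by (rule vec_lambda_measurable) measurable
  have "g (\<chi> j. f (h j)) = f" if "f \<in> space ?P" for f
    using that h(1) by (auto simp: g_def space_PiM PiE_iff extensional_def fun_eq_iff)
  then have "(\<lambda>f. \<chi> j. f (h j)) -` (g -` E) \<inter> space ?P = E"
    using sets.sets_into_space[OF E(1)] by auto
  then have "emeasure lborel (g -` E) = 0"
    using E(3) N m by (subst distr_PiM_lborel_vec[OF h(1), symmetric]) (simp add: emeasure_distr)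
  then have "g -` E \<in> null_sets lborel" using N by (auto intro: null_setsI)
  moreover have "g (\<chi> j. x \<bullet> h j) = c x" for x
    using h(1) by (auto simp: g_def c_def fun_eq_iff)
  then have "(\<lambda>x. (\<chi> j. x \<bullet> h j) :: real ^ 'n) ` A \<subseteq> g -` E" using E(2) by auto
  ultimately show False using A by blast
qed

section \<open>Essential closure against topological closure\<close>

text \<open>A neighborhood that misses \<open>A\<close> meets it in the empty set, whose projections
  have outer measure zero.\<close>

lemma ess_closure_subset_closure: "ess_closure d A \<subseteq> closure A"
proof
  fix x assume x: "x \<in> ess_closure d A"
  have "G \<inter> A \<noteq> {}" if "open G" "x \<in> G" for G
  proof
    assume "G \<inter> A = {}"
    moreover have "outer_measure_of M {} = 0" for M :: "('a \<Rightarrow> real) measure"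
      using outer_measure_of_eq[of "{}" M] by simp
    ultimately show False
      using x that by (auto simp: ess_closure_def lebesgue_outer_on_def)
  qed
  then show "x \<in> closure A"
    by (auto simp: closure_iff_nhds_not_empty)
qed

section \<open>Hausdorff measure under 1-Lipschitz maps\<close>

text \<open>A bounded set \<open>E\<close> is mapped into a cube of side
  \<open>2 * diameter E\<close>. For diameter at most 1 and \<open>s < DIM('b)\<close> its volume is
  at most \<open>2 ^ DIM('b)\<close> times the \<open>s\<close>-weight of \<open>E\<close>, so
  covers of small weight give covers of the image of small volume.\<close>

lemma hausdorff_measure_0_null_image:
  fixes A :: "'a::metric_space set" and p :: "'a \<Rightarrow> 'b::euclidean_space" and s :: real
  assumes lip: "\<And>x y. dist (p x) (p y) \<le> dist x y"
    and s: "0 \<le> s" "s < DIM('b)" and A: "hausdorff_measure s A = 0"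
  obtains N where "N \<in> null_sets lborel" "p ` A \<subseteq> N"
proof -
  let ?D = "DIM('b)"
  \<comment> \<open>The centre is the image of an arbitrary point of \<open>E\<close>, and the
    Lipschitz bound makes \<open>diameter E\<close> a sufficient half-side. The empty set stays
    empty, matching its weight 0 in \<open>diam_powr\<close>.\<close>
  define Q where "Q E = (if E = {} then {} else
      let a = p (SOME x. x \<in> E) in cbox (a - diameter E *\<^sub>R One) (a + diameter E *\<^sub>R One))" for E
  have Q_sets[measurable]: "Q E \<in> sets borel" for E by (simp add: Q_def Let_def)
  have Q_sub: "p ` E \<subseteq> Q E" if "bounded E" for E
  proof
    fix z assume "z \<in> p ` E"
    then obtain x where x: "x \<in> E" "z = p x" by blast
    then have "(SOME x. x \<in> E) \<in> E" by (auto intro: someI)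
    then have "dist (p x) (p (SOME x. x \<in> E)) \<le> diameter E"
      by (rule order_trans[OF lip diameter_bounded_bound[OF that x(1)]])
    then have "\<bar>z \<bullet> b - p (SOME x. x \<in> E) \<bullet> b\<bar> \<le> diameter E" if "b \<in> Basis" for b
      using Basis_le_norm[OF that, of "z - p (SOME x. x \<in> E)"] x(2)
      by (simp add: dist_norm inner_diff_left)
    then have "p (SOME x. x \<in> E) \<bullet> b - diameter E \<le> z \<bullet> b \<and>
        z \<bullet> b \<le> p (SOME x. x \<in> E) \<bullet> b + diameter E" if "b \<in> Basis" for b
      using that by (smt (verit))
    moreover have "E \<noteq> {}" using x(1) by auto
    ultimately show "z \<in> Q E"
      by (simp add: Q_def Let_def mem_box inner_diff_left inner_add_left)
  qed
  have Q_le: "emeasure lborel (Q E) \<le> 2 ^ ?D * diam_powr s E" if "bounded E" "diameter E \<le> 1" for E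
  proof (cases "E = {}")
    case False
    let ?d = "diameter E"
    have d: "0 \<le> ?d" using that diameter_ge_0 by blast
    have "emeasure lborel (Q E) = ennreal ((2 * ?d) ^ ?D)"
      using False d by (simp add: Q_def Let_def emeasure_lborel_cbox_eq inner_diff_left inner_add_left)
    also have "\<dots> \<le> ennreal (2 ^ ?D * (if s = 0 then 1 else ?d powr s))"
    proof (rule ennreal_leI)
      \<comment> \<open>Lowering the exponent from \<open>?D\<close> to \<open>s\<close> can only
        increase the power of a number in \<open>(0, 1]\<close>; diameter 0 is treated apart. For
        \<open>s = 0\<close> the weight is 1, and the later bound \<open>?d ^ ?D \<le> 1\<close>
        applies.\<close>
      have "?d ^ ?D \<le> ?d powr s" if "s \<noteq> 0"
      proof (cases "?d = 0")
        case False
        then have "?d ^ ?D = ?d powr ?D" using d by (simp add: powr_realpow)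
        also have "\<dots> \<le> ?d powr s"
          using d \<open>?d \<le> 1\<close> s False by (intro powr_mono') auto
        finally show ?thesis .
      qed (simp add: zero_power)
      moreover have "?d ^ ?D \<le> 1" using d \<open>?d \<le> 1\<close> by (simp add: power_le_one)
      ultimately show "(2 * ?d) ^ ?D \<le> 2 ^ ?D * (if s = 0 then 1 else ?d powr s)"
        by (simp add: power_mult_distrib)
    qed
    also have "\<dots> = 2 ^ ?D * diam_powr s E"
      using False by (subst ennreal_mult) (auto simp: diam_powr_def simp flip: ennreal_power)
    finally show ?thesis .
  qed (simp add: Q_def)
  \<comment> \<open>The scale 1 is below the supremum over all scales, and it supplies the diameter
    bound in \<open>Q_le\<close>.\<close>
  have "hausdorff_premeasure s 1 A \<le> hausdorff_measure s A"
    unfolding hausdorff_measure_def by (rule SUP_upper) simp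
  then have zero: "hausdorff_premeasure s 1 A = 0" using A by simp
  let ?cover = "\<lambda>E :: nat \<Rightarrow> 'a set. A \<subseteq> (\<Union>i. E i) \<and> (\<forall>i. bounded (E i) \<and> diameter (E i) \<le> 1)"
  have "\<forall>k. \<exists>E. ?cover E \<and> (\<Sum>i. diam_powr s (E i)) < ennreal (1 / Suc k)"
  proof
    fix k
    have "hausdorff_premeasure s 1 A < ennreal (1 / Suc k)" by (simp add: zero)
    then show "\<exists>E. ?cover E \<and> (\<Sum>i. diam_powr s (E i)) < ennreal (1 / Suc k)"
      unfolding hausdorff_premeasure_def INF_less_iff by blast
  qed
  from choice[OF this] obtain E where
    "\<forall>k. ?cover (E k) \<and> (\<Sum>i. diam_powr s (E k i)) < ennreal (1 / Suc k)" ..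
  then have E: "A \<subseteq> (\<Union>i. E k i)" "bounded (E k i)" "diameter (E k i) \<le> 1"
    "(\<Sum>i. diam_powr s (E k i)) < ennreal (1 / Suc k)" for k i
    by blast+
  \<comment> \<open>Each \<open>k\<close> alone gives a cover of small volume; the intersection
    still contains the image and has measure at most \<open>2 ^ ?D / Suc k\<close> for every
    \<open>k\<close>.\<close>
  define N where "N = (\<Inter>k. \<Union>i. Q (E k i))"
  have [measurable]: "N \<in> sets borel" unfolding N_def by measurable
  have bound: "emeasure lborel N \<le> ennreal (2 ^ ?D * (1 / Suc k))" for k
  proof -
    have "emeasure lborel N \<le> emeasure lborel (\<Union>i. Q (E k i))"
      by (rule emeasure_mono) (auto simp: N_def)
    also have "\<dots> \<le> (\<Sum>i. emeasure lborel (Q (E k i)))"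
      by (rule emeasure_subadditive_countably) auto
    also have "\<dots> \<le> (\<Sum>i. 2 ^ ?D * diam_powr s (E k i))"
      by (intro suminf_le Q_le E) auto
    also have "\<dots> = 2 ^ ?D * (\<Sum>i. diam_powr s (E k i))" by simp
    also have "\<dots> \<le> 2 ^ ?D * ennreal (1 / Suc k)"
      by (intro mult_left_mono order.strict_implies_order[OF E(4)]) auto
    also have "\<dots> = ennreal (2 ^ ?D * (1 / Suc k))"
      by (subst ennreal_mult) (auto simp flip: ennreal_power)
    finally show ?thesis .
  qed
  have "(\<lambda>k. ennreal (2 ^ ?D * (1 / Suc k))) \<longlonglongrightarrow> ennreal (2 ^ ?D * 0)"
    by (intro tendsto_ennrealI tendsto_mult_left LIMSEQ_Suc lim_1_over_n)
  then have "emeasure lborel N \<le> ennreal (2 ^ ?D * 0)"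
    by (rule LIMSEQ_le_const) (use bound in auto)
  then have "N \<in> null_sets lborel" by (auto intro!: null_setsI)
  moreover have "p ` A \<subseteq> N"
  proof (unfold N_def, intro INT_greatest)
    fix k
    have "p ` A \<subseteq> (\<Union>i. p ` E k i)" using E(1)[of k] by blast
    also have "\<dots> \<subseteq> (\<Union>i. Q (E k i))" by (intro UN_mono Q_sub E) auto
    finally show "p ` A \<subseteq> (\<Union>i. Q (E k i))" .
  qed
  ultimately show ?thesis by (rule that)
qed

text \<open>Every exponent in the infimum is at least \<open>DIM('b)\<close>, since a smaller one
  would make the image null.\<close>

lemma hausdorff_dim_ge:
  fixes A :: "'a::metric_space set" and p :: "'a \<Rightarrow> 'b::euclidean_space"
  assumes lip: "\<And>x y. dist (p x) (p y) \<le> dist x y"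
    and A: "\<And>N. N \<in> null_sets lborel \<Longrightarrow> \<not> p ` A \<subseteq> N"
  shows "of_nat DIM('b) \<le> hausdorff_dim A"
  unfolding hausdorff_dim_def
proof (rule INF_greatest)
  fix s :: real
  assume s: "s \<in> {s. 0 \<le> s \<and> hausdorff_measure s A = 0}"
  have "real DIM('b) \<le> s"
  proof (rule ccontr)
    assume "\<not> real DIM('b) \<le> s"
    then obtain N where "N \<in> null_sets lborel" "p ` A \<subseteq> N"
      using hausdorff_measure_0_null_image[OF lip, of s A] s by auto
    then show False using A by blast
  qed
  then show "of_nat DIM('b) \<le> ennreal s"
    by (metis ennreal_leI ennreal_of_nat_eq_real_of_nat)
qed

section \<open>Uniform random vectors and their copula measure\<close>

lemma uniform01_null:
  assumes "prob_space M" "uniform01 M X" "N \<in> null_sets (lborel :: real measure)"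
  shows "AE \<omega> in M. X \<omega> \<notin> N"
proof -
  have m[measurable]: "X \<in> borel_measurable M" using assms by (simp add: uniform01_def)
  have [measurable]: "N \<in> sets borel" using assms(3) by auto
  have "AE x in uniform_measure lborel {0..1::real}. x \<notin> N"
    by (rule AE_uniform_measureI) (use AE_not_in[OF assms(3)] in auto)
  then have "AE x in distr M borel X. x \<notin> N"
    by (subst conjunct2[OF assms(2)[unfolded uniform01_def]])
  then show ?thesis by (subst (asm) AE_distr_iff) auto
qed

lemma AE_uniform01_vec_in_unit_cube:
  fixes X :: "'k::finite \<Rightarrow> 'w \<Rightarrow> real"
  assumes "prob_space M" "\<And>i. uniform01 M (X i)"
  shows "AE \<omega> in M. (\<chi> i. X i \<omega>) \<in> unit_cube"
proof -
  have "AE \<omega> in M. \<forall>i. X i \<omega> \<in> {0..1}"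
    using uniform01_range[OF assms] by (subst AE_all_countable) auto
  then show ?thesis by (auto simp: mem_box_cart)
qed

text \<open>The copula measure is the law of the vector restricted to the unit cube, where the
  vector lies almost surely.\<close>

lemma AE_copula_measure_iff:
  fixes X :: "'k::finite \<Rightarrow> 'w \<Rightarrow> real"
  assumes "prob_space M" and u: "\<And>i. uniform01 M (X i)" and A: "A \<in> sets borel"
  shows "(AE x in copula_measure (copula_of M X). x \<in> A) \<longleftrightarrow> (AE \<omega> in M. (\<chi> i. X i \<omega>) \<in> A)"
proof -
  have m: "(\<lambda>\<omega>. \<chi> i. X i \<omega>) \<in> borel_measurable M"
    by (rule vec_lambda_measurable) (use u in \<open>simp add: uniform01_def\<close>)
  have "(AE x in copula_measure (copula_of M X). x \<in> A) \<longleftrightarrow>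
      (AE \<omega> in M. (\<chi> i. X i \<omega>) \<in> unit_cube \<longrightarrow> (\<chi> i. X i \<omega>) \<in> A)"
    using A unfolding copula_measure_copula_of(2)[OF assms(1,2)]
    by (subst AE_restrict_space_iff, simp, subst AE_distr_iff[OF m]) simp_all
  also have "\<dots> \<longleftrightarrow> (AE \<omega> in M. (\<chi> i. X i \<omega>) \<in> A)"
    by (rule eventually_subst, rule eventually_mono[OF AE_uniform01_vec_in_unit_cube[OF assms(1,2)]]) auto
  finally show ?thesis .
qed

lemma space_copula_measure:
  fixes X :: "'k::finite \<Rightarrow> 'w \<Rightarrow> real"
  assumes "prob_space M" "\<And>i. uniform01 M (X i)"
  shows "space (copula_measure (copula_of M X)) = unit_cube"
  by (simp add: copula_measure_copula_of(2)[OF assms] space_restrict_space)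

lemma closed_copula_support:
  fixes X :: "'k::finite \<Rightarrow> 'w \<Rightarrow> real"
  assumes "prob_space M" "\<And>i. uniform01 M (X i)"
  shows "closed (copula_support (copula_of M X))"
  unfolding copula_support_def
  by (rule closed_measure_support) (simp add: space_copula_measure[OF assms] closed_cbox)

lemma AE_copula_support:
  fixes X :: "'k::finite \<Rightarrow> 'w \<Rightarrow> real"
  assumes "prob_space M" "\<And>i. uniform01 M (X i)"
  shows "AE \<omega> in M. (\<chi> i. X i \<omega>) \<in> copula_support (copula_of M X)"
proof -
  have "AE x in copula_measure (copula_of M X). x \<in> copula_support (copula_of M X)"
    unfolding copula_support_def
    by (rule AE_measure_support)
      (auto simp: copula_measure_copula_of(2)[OF assms] space_restrict_space sets_restrict_space)
  then show ?thesis
    by (subst (asm) AE_copula_measure_iff[OF assms borel_closed[OF closed_copula_support[OF assms]]])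
qed

text \<open>A point of the support has only neighborhoods of positive measure, whereas almost sure
  avoidance would make \<open>G\<close> null.\<close>

lemma copula_support_open_Int_not_null:
  fixes X :: "'k::finite \<Rightarrow> 'w \<Rightarrow> real"
  assumes "prob_space M" "\<And>i. uniform01 M (X i)"
    and "open G" and ne: "G \<inter> copula_support (copula_of M X) \<noteq> {}"
  shows "\<not> (AE \<omega> in M. (\<chi> i. X i \<omega>) \<notin> G)"
proof
  let ?\<mu> = "copula_measure (copula_of M X)"
  assume "AE \<omega> in M. (\<chi> i. X i \<omega>) \<notin> G"
  then have "AE x in ?\<mu>. x \<in> - G"
    using \<open>open G\<close> by (subst AE_copula_measure_iff[OF assms(1,2)]) auto
  moreover have "{x \<in> space ?\<mu>. \<not> x \<in> - G} = G \<inter> space ?\<mu>" by auto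
  moreover have "G \<inter> space ?\<mu> \<in> sets ?\<mu>"
    using \<open>open G\<close> by (auto simp: copula_measure_copula_of(2)[OF assms(1,2)]
        space_restrict_space sets_restrict_space)
  ultimately have "emeasure ?\<mu> (G \<inter> space ?\<mu>) = 0" by (simp add: AE_iff_measurable)
  then show False
    using ne \<open>open G\<close> by (auto simp: copula_support_def measure_support_def)
qed

text \<open>This identifies \<open>real ^ 'n\<close> with \<open>real\<close> for
  \<open>n = 1\<close>, where the uniform law of the single variable replaces absolute
  continuity.\<close>

lemma lborel_vec_card_1:
  assumes "CARD('n::finite) = 1"
  shows "distr lborel borel (\<lambda>t. \<chi> j. t) = (lborel :: (real ^ 'n) measure)"
proof (rule lborel_eqI[symmetric])
  obtain j :: 'n where j: "UNIV = {j}" using assms by (auto simp: card_1_singleton_iff)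
  have m: "(\<lambda>t. (\<chi> j. t) :: real ^ 'n) \<in> borel_measurable lborel"
    by (rule vec_lambda_measurable) simp
  fix l u :: "real ^ 'n"
  assume "\<And>b. b \<in> Basis \<Longrightarrow> l \<bullet> b \<le> u \<bullet> b"
  from this[of "axis j 1" for j] have le: "l $ j \<le> u $ j" for j
    by (simp add: axis_in_Basis_iff inner_axis)
  have all: "(\<forall>i. P i) \<longleftrightarrow> P j" for P
  proof -
    have "i = j" for i using j by auto
    then show ?thesis by metis
  qed
  have "(\<lambda>t. \<chi> j. t) -` box l u = {l $ j <..< u $ j}"
    by (auto simp: mem_box_cart all)
  then have "emeasure (distr lborel borel (\<lambda>t. \<chi> j. t)) (box l u) = ennreal (u $ j - l $ j)"
    using m le by (simp add: emeasure_distr)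
  also have "\<dots> = (\<Prod>b\<in>Basis. (u - l) \<bullet> b)"
    using prod_ennreal_vec_Basis[OF le] unfolding j by simp
  finally show "emeasure (distr lborel borel (\<lambda>t. \<chi> j. t)) (box l u) = (\<Prod>b\<in>Basis. (u - l) \<bullet> b)" .
qed simp

lemma uniform01_vec_null:
  fixes X :: "'n::finite \<Rightarrow> 'w \<Rightarrow> real"
  assumes "prob_space M" and u: "\<And>i. uniform01 M (X i)"
    and ac: "CARD('n) \<ge> 2 \<Longrightarrow>
      absolutely_continuous (restrict_space lborel unit_cube) (copula_measure (copula_of M X))"
    and N: "N \<in> null_sets lborel"
  shows "AE \<omega> in M. (\<chi> i. X i \<omega>) \<notin> N"
proof (cases "CARD('n) \<ge> 2")
  case True
  let ?\<mu> = "copula_measure (copula_of M X)"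
  \<comment> \<open>Both measures live on the cube, so \<open>N\<close> is first cut down to it;
    \<open>absolutely_continuous\<close> then passes null sets from its first argument to its
    second.\<close>
  have "N \<inter> unit_cube \<in> null_sets (restrict_space lborel unit_cube)"
    using N by (subst null_sets_restrict_space) (auto intro: null_set_Int2)
  then have "N \<inter> unit_cube \<in> null_sets ?\<mu>"
    using ac[OF True] by (auto simp: absolutely_continuous_def)
  then have "AE x in ?\<mu>. x \<notin> N \<inter> unit_cube" by (rule AE_not_in)
  then have "AE x in ?\<mu>. x \<in> - N"
    by (rule AE_mp) (auto intro!: AE_I2 simp: space_copula_measure[OF assms(1,2)])
  then show ?thesis
    using N by (subst (asm) AE_copula_measure_iff[OF assms(1,2)]) auto
next
  case False
  then have c: "CARD('n) = 1" using zero_less_card_finite[where 'a='n] by linarith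
  then obtain j :: 'n where j: "UNIV = {j}" by (auto simp: card_1_singleton_iff)
  have m: "(\<lambda>t. (\<chi> j. t) :: real ^ 'n) \<in> borel_measurable lborel"
    by (rule vec_lambda_measurable) simp
  have "(\<lambda>t. \<chi> j. t) -` N \<in> null_sets lborel"
    using N m measurable_sets[OF m, of N] unfolding lborel_vec_card_1[OF c, symmetric]
    by (simp add: null_sets_distr_iff)
  then have "AE \<omega> in M. X j \<omega> \<notin> (\<lambda>t. \<chi> j. t) -` N"
    by (rule uniform01_null[OF assms(1) u])
  moreover have "(\<chi> i. X i \<omega>) = (\<chi> i. X j \<omega>)" for \<omega>
  proof -
    have "i = j" for i using j by auto
    then have "\<forall>i. X i \<omega> = X j \<omega>" by metis
    then show ?thesis unfolding vec_eq_iff vec_lambda_beta .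
  qed
  ultimately show ?thesis by simp
qed

theorem corollary3p3p4:
  fixes M :: "'w measure" and U :: "'n::finite + 'm::finite \<Rightarrow> 'w \<Rightarrow> real"
    and C :: "real ^ ('n + 'm) \<Rightarrow> real" and C_U :: "real ^ 'n \<Rightarrow> real"
  assumes "prob_space M"
    and "\<And>i. uniform01 M (U i)"
    and "C = copula_of M U"
    and "C_U = copula_of M (\<lambda>j. U (Inl j))"
    and "CARD('n) \<ge> 2 \<Longrightarrow>
           absolutely_continuous (copula_measure C_U) (restrict_space lborel unit_cube) \<and>
           absolutely_continuous (restrict_space lborel unit_cube) (copula_measure C_U)"
    and "\<And>i. \<exists>f :: real ^ 'n \<Rightarrow> real.
           f \<in> borel_measurable (restrict_space borel unit_cube) \<and> f \<in> unit_cube \<rightarrow> {0..1} \<and>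
           (AE \<omega> in M. U (Inr i) \<omega> = f (\<chi> j. U (Inl j) \<omega>))"
  shows "ess_closed CARD('n) (copula_support C) \<and>
         (\<forall>G. open G \<longrightarrow> G \<inter> copula_support C \<noteq> {} \<longrightarrow>
            hausdorff_dim (G \<inter> copula_support C) \<ge> of_nat CARD('n))"
proof -
  let ?S = "copula_support C"
  \<comment> \<open>\<open>h\<close> lists the first \<open>n\<close> basis vectors. Their span is
    the witness subspace for every point and every neighborhood, and \<open>p\<close> takes
    coordinates in it.\<close>
  define h :: "'n \<Rightarrow> real ^ ('n + 'm)" where "h j = axis (Inl j) 1" for j
  define p :: "real ^ ('n + 'm) \<Rightarrow> real ^ 'n" where "p x = (\<chi> j. x \<bullet> h j)" for x
  have h: "inj h" "range h \<subseteq> Basis"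
    by (auto simp: h_def inj_on_def axis_eq_axis Basis_vec_def)
  have p: "p x = (\<chi> j. x $ Inl j)" for x by (simp add: p_def h_def inner_axis)
  have closed: "closed ?S"
    unfolding assms(3) by (rule closed_copula_support[OF assms(1,2)])
  have pos: "\<not> p ` (G \<inter> ?S) \<subseteq> N"
    if G: "open G" "G \<inter> ?S \<noteq> {}" and N: "N \<in> null_sets lborel" for G N
  proof
    assume sub: "p ` (G \<inter> ?S) \<subseteq> N"
    \<comment> \<open>The second conjunct is the direction in which Lebesgue null sets are null for
      the law of the first \<open>n\<close> variables.\<close>
    have "AE \<omega> in M. (\<chi> j. U (Inl j) \<omega>) \<notin> N"
      by (rule uniform01_vec_null[OF assms(1,2) assms(5)[THEN conjunct2, unfolded assms(4)] N])
    moreover have "AE \<omega> in M. (\<chi> i. U i \<omega>) \<in> ?S"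
      unfolding assms(3) by (rule AE_copula_support[OF assms(1,2)])
    \<comment> \<open>A value in \<open>G\<close> would also lie in the support, and its first
      \<open>n\<close> coordinates would then fall in \<open>N\<close>.\<close>
    ultimately have "AE \<omega> in M. (\<chi> i. U i \<omega>) \<notin> G"
    proof eventually_elim
      case (elim \<omega>)
      have "(\<chi> j. U (Inl j) \<omega>) = p (\<chi> i. U i \<omega>)" by (simp add: p)
      then show ?case using sub elim by (metis IntI image_eqI subsetD)
    qed
    then show False
      using copula_support_open_Int_not_null[where X = U, OF assms(1,2) G(1)] G(2)
      unfolding assms(3) by simp
  qed
  have "?S \<subseteq> ess_closure CARD('n) ?S"
  proof (unfold ess_closure_def, intro subsetI CollectI allI impI exI conjI)
    fix x G assume x: "x \<in> ?S" "open G" "x \<in> G"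
    show "std_subspace (span (range h))" using h(2) by (auto simp: std_subspace_def)
    have "independent (range h)" using h(2) independent_Basis independent_mono by blast
    then show "dim (span (range h)) = CARD('n)"
      using h(1) by (simp add: dim_span dim_eq_card_independent card_image)
    show "0 < lebesgue_outer_on (span (range h)) (orth_proj (span (range h)) ` (G \<inter> ?S))"
      by (rule lebesgue_outer_on_pos[OF h]) (use pos x in \<open>auto simp: p_def[abs_def]\<close>)
  qed
  moreover have "ess_closure CARD('n) ?S \<subseteq> ?S"
    using ess_closure_subset_closure closure_closed[OF closed] by blast
  moreover have "of_nat CARD('n) \<le> hausdorff_dim (G \<inter> ?S)" if "open G" "G \<inter> ?S \<noteq> {}" for G
  proof -
    have "dist (p x) (p y) \<le> dist x y" for x y
    proof -
      \<comment> \<open>The squared norm of the image sums the squares over only some of the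
        coordinates, so \<open>p\<close> is 1-Lipschitz.\<close>
      have "(norm (p (x - y)))\<^sup>2 = (\<Sum>i\<in>range (Inl :: 'n \<Rightarrow> 'n + 'm). ((x - y) $ i)\<^sup>2)"
        by (simp add: norm_vec_def L2_set_def sum_nonneg p sum.reindex)
      also have "\<dots> \<le> (norm (x - y))\<^sup>2"
        by (simp add: norm_vec_def L2_set_def sum_nonneg sum_mono2)
      finally have "norm (p (x - y)) \<le> norm (x - y)" by (simp add: power2_le_iff_abs_le)
      moreover have "p (x - y) = p x - p y" by (simp add: p vec_eq_iff)
      ultimately show ?thesis by (simp add: dist_norm)
    qed
    from hausdorff_dim_ge[OF this pos[OF that]] show ?thesis by simp
  qed
  ultimately show ?thesis by (auto simp: ess_closed_def)
qed

end
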